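(* Fix an integer $k\ge 1$. For every integer $n\ge 0$, the number of partitions of $n$ satisfying condition (P) equals the number of partitions of $n$ satisfying condition (S), where: (P) every part is either even or $\equiv 2k+3 \pmod{4k+8}$. (S) all of the following hold: - the difference between consecutive (adjacent) parts is never any of $1,3,\dots,2k+1$; - an even part $2j$ is never immediately adjacent to $2j-2k-3$; - (initial condition, given by a fictitious zero) the smallest part is not equal to any of $1,3,\dots,2k+1$. Moreover, the generating function of the partitions satisfying (P) is the periodic infinite product $\prod_m (1-q^m)^{-1}$ over all $m\ge1$ with $m$ even or $m\equiv 2k+3\pmod{4k+8}$; and a partition satisfies (S) if and only if its conjugate satisfies the following condition (C): (C) both of the following hold: - no part appears exactly $1$, $3$, $\dots$, or $2k+1$ times; - if a part appears exactly $2k+3$ times, then there are an even number of parts strictly greater than it.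
   Context: Partitions $\lambda=(\lambda_1\ge\lambda_2\ge\dots\ge\lambda_r)$ have positive integer parts. Two parts are consecutive, or (immediately) adjacent, if they are $\lambda_i,\lambda_{i+1}$ for some $1\le i<r$. The initial condition is "given by a fictitious zero" if it is what the difference/adjacency conditions impose when one part equal to $0$ is appended to the partition. Numbers of parts are counted with multiplicity (zero is even). The conjugate of a partition is obtained by transposing its Ferrers diagram. *)

theory Defs
  imports
    "HOL-Analysis.Infinite_Products"
    "HOL-Computational_Algebra.Formal_Power_Series"
    "HOL-Number_Theory.Cong"
begin

definition is_partition :: "nat list \<Rightarrow> bool" where
  "is_partition l \<longleftrightarrow> sorted_wrt (\<ge>) l \<and> (\<forall>p\<in>set l. p > 0)"

definition partitions_of :: "nat \<Rightarrow> nat list set" where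
  "partitions_of n = {l. is_partition l \<and> sum_list l = n}"

definition adjacent :: "nat list \<Rightarrow> nat \<Rightarrow> nat \<Rightarrow> bool" where
  "adjacent l a b \<longleftrightarrow> (\<exists>i. Suc i < length l \<and> l ! i = a \<and> l ! Suc i = b)"

(* The forbidden numbers 1, 3, ..., 2k+1. *)
definition small_odds :: "nat \<Rightarrow> nat set" where
  "small_odds k = {d. odd d \<and> d \<le> 2 * k + 1}"

definition cond_P :: "nat \<Rightarrow> nat list \<Rightarrow> bool" where
  "cond_P k l \<longleftrightarrow> (\<forall>p\<in>set l. even p \<or> [p = 2 * k + 3] (mod (4 * k + 8)))"

(* The difference a - b does not truncate: adjacent parts of a partition satisfy b <= a. *)
definition cond_S :: "nat \<Rightarrow> nat list \<Rightarrow> bool" where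
  "cond_S k l \<longleftrightarrow>
     (\<forall>a b. adjacent l a b \<longrightarrow> a - b \<notin> small_odds k) \<and>
     (\<forall>j b. adjacent l (2 * j) b \<longrightarrow> int b \<noteq> 2 * int j - 2 * int k - 3) \<and>
     (l \<noteq> [] \<longrightarrow> Min (set l) \<notin> small_odds k)"

definition cond_C :: "nat \<Rightarrow> nat list \<Rightarrow> bool" where
  "cond_C k l \<longleftrightarrow>
     (\<forall>p\<in>set l. count_list l p \<notin> small_odds k) \<and>
     (\<forall>p\<in>set l. count_list l p = 2 * k + 3 \<longrightarrow> even (length (filter (\<lambda>x. x > p) l)))"

definition ferrers :: "nat list \<Rightarrow> (nat \<times> nat) set" where
  "ferrers l = {(i, j). i < length l \<and> j < l ! i}"

(* Column lengths of the Ferrers diagram; for a partition the number of columns is its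
   first part.  That this transposes the diagram is lemma ferrers_conjugate below. *)
definition conjugate :: "nat list \<Rightarrow> nat list" where
  "conjugate l =
     (case l of [] \<Rightarrow> [] | m # _ \<Rightarrow> map (\<lambda>j. card {i. (i, j) \<in> ferrers l}) [0..<m])"

definition P_gf :: "nat \<Rightarrow> rat fps" where
  "P_gf k = Abs_fps (\<lambda>n. of_nat (card {l \<in> partitions_of n. cond_P k l}))"

lemma finite_partitions_of: "finite (partitions_of n)"
proof -
  have "length l \<le> sum_list l" if "\<forall>p\<in>set l. p > 0" for l :: "nat list"
    using that by (induction l) auto
  then have "partitions_of n \<subseteq> {l. set l \<subseteq> {..n} \<and> length l \<le> n}"
    by (auto simp: partitions_of_def is_partition_def member_le_sum_list)
  then show ?thesis
    using finite_lists_length_le[of "{..n}" n] finite_subset by blast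
qed

lemma partition_nth_mono:
  assumes "is_partition l" "i \<le> j" "j < length l"
  shows "l ! j \<le> l ! i"
  using assms by (cases "i = j") (auto simp: is_partition_def sorted_wrt_iff_nth_less)

lemma column_eq_lessThan:
  assumes "is_partition l"
  shows "{i. (i, j) \<in> ferrers l} = {..<card {i. (i, j) \<in> ferrers l}}" (is "?C = _")
proof -
  have fin: "finite ?C"
    by (rule finite_subset[of _ "{..<length l}"]) (auto simp: ferrers_def)
  have down: "i' \<in> ?C" if "i \<in> ?C" "i' \<le> i" for i i'
    using that partition_nth_mono[OF assms, of i' i] by (auto simp: ferrers_def)
  have "?C \<subseteq> {..<card ?C}"
  proof
    fix i assume "i \<in> ?C"
    then have "{..i} \<subseteq> ?C" using down by blast
    then have "card {..i} \<le> card ?C" using card_mono fin by blast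
    then show "i \<in> {..<card ?C}" by simp
  qed
  then show ?thesis by (simp add: card_subset_eq)
qed

lemma conjugate_nth:
  "j < length (conjugate l) \<Longrightarrow> conjugate l ! j = card {i. (i, j) \<in> ferrers l}"
  by (cases l) (auto simp: conjugate_def simp del: upt.simps)

lemma ferrers_conjugate:
  assumes "is_partition l"
  shows "ferrers (conjugate l) = (ferrers l)\<inverse>"
proof -
  have len: "j < length (conjugate l)" if "(i, j) \<in> ferrers l" for i j
    using that partition_nth_mono[OF assms, of 0 i]
    by (cases l) (auto simp: conjugate_def ferrers_def simp del: upt.simps)
  have iff: "i < conjugate l ! j \<longleftrightarrow> (i, j) \<in> ferrers l" if "j < length (conjugate l)" for i j
    using column_eq_lessThan[OF assms, of j] conjugate_nth[OF that] by auto
  have "(j, i) \<in> ferrers (conjugate l) \<longleftrightarrow> (i, j) \<in> ferrers l" for i j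
    using len[of i j] iff[of j i] by (auto simp: ferrers_def[of "conjugate l"])
  then show ?thesis by auto
qed

lemma is_partition_conjugate:
  assumes "is_partition l"
  shows "is_partition (conjugate l)"
proof -
  have pos: "conjugate l ! j > 0" if j: "j < length (conjugate l)" for j
  proof -
    have "(0, j) \<in> ferrers l"
      using j by (cases l) (auto simp: conjugate_def ferrers_def)
    then show ?thesis
      using column_eq_lessThan[OF assms, of j] conjugate_nth[OF j] by auto
  qed
  have mono: "conjugate l ! j' \<le> conjugate l ! j" if "j < j'" "j' < length (conjugate l)" for j j'
  proof -
    have "card {i. (i, j') \<in> ferrers l} \<le> card {i. (i, j) \<in> ferrers l}"
      by (rule card_mono, rule finite_subset[of _ "{..<length l}"])
         (use that in \<open>auto simp: ferrers_def\<close>)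
    then show ?thesis using that by (simp add: conjugate_nth)
  qed
  show ?thesis
    unfolding is_partition_def sorted_wrt_iff_nth_less
    using pos mono by (auto simp: in_set_conv_nth)
qed

end

theory Submission
  imports Defs "HOL-Library.Equipollence" "HOL-Library.Multiset"
begin

text \<open>
Transposing the Ferrers diagram turns differences of adjacent parts into multiplicities, and the
value of a part into the number of larger parts; this translates condition (S) into (C), so it
suffices to count the partitions with (C). Regarded as a multiset, such a partition \<open>M\<close> is
determined by the finite set \<open>D\<close> of parts with odd multiplicity and an arbitrary multiset \<open>H\<close>. List
\<open>D\<close> as \<open>d\<^sub>1 > d\<^sub>2 > \<dots>\<close>. The parity of the number of parts of \<open>M\<close> above \<open>d\<^sub>i\<close> is the parity of
\<open>i - 1\<close>, so (C) says exactly that \<open>d\<^sub>i\<close> has multiplicity at least \<open>2k+3\<close> for odd \<open>i\<close> and at least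
\<open>2k+5\<close> for even \<open>i\<close>. Removing these minimal copies leaves even multiplicities, that is \<open>H + H\<close>
(\<open>bij_betw_C_data\<close>).

Let \<open>e = d\<^sub>2 + d\<^sub>4 + \<dots>\<close> and let \<open>a = d\<^sub>1 - d\<^sub>2 + d\<^sub>3 - \<dots>\<close> be the alternating sum. The removed copies
weigh \<open>(2k+3)(e + a) + (2k+5)e = (2k+3)a + (4k+8)e\<close>. On the side of (P), the even parts form a
doubled multiset \<open>H\<close>, and writing the odd parts as \<open>(4k+8)c + (2k+3)\<close> gives a multiset of numbers
\<open>c\<close>; if there are \<open>a\<close> of them and their sum is \<open>e\<close>, the weight is the same
(\<open>bij_betw_P_data\<close>). The theorem is thereby reduced to a refined form of Euler's
theorem that goes back to Sylvester: the strict partitions with alternating sum \<open>a\<close> and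
even-indexed sum \<open>e\<close> are equinumerous with the multisets of \<open>a\<close> natural numbers with sum \<open>e\<close>, or
equivalently with the partitions of \<open>2e + a\<close> into \<open>a\<close> odd parts (\<open>strict_parts_eqpoll\<close>).

That statement is proved by showing that both families satisfy \<open>X(e, a) = X(e, a-1) + X(e-a, a)\<close> for
\<open>a > 0\<close>, where the last term is absent if \<open>e < a\<close>. For multisets, either some element is \<open>0\<close> and is removed, or all elements are decreased by
\<open>1\<close>. For strict partitions, either the first part can be decreased by \<open>1\<close>, or the second part is
just one less than the first; in the latter case the first part is removed and the even-indexed parts
of the rest are reflected in the intervals between their neighbours (\<open>reflect\<close>).

The infinite product has one geometric series for each admissible part, and its partial products
converge coefficientwise (\<open>parts_gf_has_prod\<close>).
\<close>

section \<open>Strict partitions by alternating sum\<close>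

fun osum :: "nat list \<Rightarrow> nat" and esum :: "nat list \<Rightarrow> nat" where
  "osum [] = 0"
| "osum (x # l) = x + esum l"
| "esum [] = 0"
| "esum (x # l) = osum l"

fun strict_partition :: "nat list \<Rightarrow> bool" where
  "strict_partition [] \<longleftrightarrow> True"
| "strict_partition [x] \<longleftrightarrow> x > 0"
| "strict_partition (x # y # l) \<longleftrightarrow> x > y \<and> strict_partition (y # l)"

lemma strict_iff: "strict_partition l \<longleftrightarrow> sorted_wrt (>) l \<and> (\<forall>x\<in>set l. x > 0)"
proof (induction l rule: strict_partition.induct)
  case (3 x y l)
  then show ?case by (auto simp only: strict_partition.simps sorted_wrt2[OF transp_on_greater] list.set insert_iff)
qed auto

lemma strict_ConsD: "strict_partition (x # l) \<Longrightarrow> strict_partition l"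
  by (cases l) auto

definition drop_zero :: "nat \<Rightarrow> nat list" where
  "drop_zero n = (if n = 0 then [] else [n])"

text \<open>Each even-indexed part \<open>y\<close>, lying strictly between its neighbours \<open>x > z\<close>, is replaced by its mirror
image \<open>x + z - y\<close>. A last odd-indexed part \<open>x\<close> is followed by \<open>y\<close> with \<open>0 \<le> y < x\<close>, where \<open>y = 0\<close>
means that no part follows; this \<open>y\<close> is reflected to \<open>x - 1 - y\<close>. The odd-indexed parts do not move,
which makes the map an involution.\<close>

fun reflect :: "nat list \<Rightarrow> nat list" where
  "reflect [] = []"
| "reflect [x] = x # drop_zero (x - 1)"
| "reflect [x, y] = x # drop_zero (x - y - 1)"
| "reflect (x # y # z # l) = x # (x + z - y) # reflect (z # l)"

lemma reflect_Cons: "\<exists>t. reflect (x # l) = x # t"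
  by (cases "x # l" rule: reflect.cases) auto

lemma strict_reflect: "strict_partition l \<Longrightarrow> strict_partition (reflect l)"
proof (induction l rule: reflect.induct)
  case (4 x y z l)
  then show ?case using reflect_Cons[of z l] by auto
qed (auto simp: drop_zero_def)

lemma reflect_reflect: "strict_partition l \<Longrightarrow> reflect (reflect l) = l"
proof (induction l rule: reflect.induct)
  case (4 x y z l)
  then show ?case using reflect_Cons[of z l] by auto
qed (auto simp: drop_zero_def)

lemma osum_reflect: "strict_partition l \<Longrightarrow> osum (reflect l) = osum l"
proof (induction l rule: reflect.induct)
  case (4 x y z l)
  then show ?case using reflect_Cons[of z l] by auto
qed (auto simp: drop_zero_def)

text \<open>A reflected pair contributes \<open>x + z\<close> to the two even-indexed sums together, the last one \<open>x - 1\<close>.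
In total every odd-indexed part occurs twice, except the first, which occurs once.\<close>

lemma esum_reflect: "strict_partition (x # l) \<Longrightarrow> esum (reflect (x # l)) + x + esum (x # l) + 1 = 2 * osum (x # l)"
proof (induction "x # l" arbitrary: x l rule: reflect.induct)
  case (4 x y z l)
  then have "z < y" "y < x" "strict_partition (z # l)" by auto
  with 4 reflect_Cons[of z l] show ?case by auto
qed (auto simp: drop_zero_def)

text \<open>The two inequalities carry one simultaneous induction, since removing the first part exchanges
the odd and the even positions.\<close>

lemma esum_le_osum: "strict_partition l \<Longrightarrow> esum l \<le> osum l" "strict_partition (x # l) \<Longrightarrow> esum l + x \<ge> osum l"
proof (induction l arbitrary: x)
  case (Cons y l)
  { case 1
    then show ?case using Cons.IH(2)[of y] by simp
  next
    case 2
    then show ?case using Cons.IH(1) strict_ConsD by fastforce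
  }
qed auto

text \<open>The equation \<open>osum l = e + a\<close> prescribes the alternating sum without a truncated subtraction.\<close>

definition strict_parts :: "nat \<Rightarrow> nat \<Rightarrow> nat list set" where
  "strict_parts e a = {l. strict_partition l \<and> esum l = e \<and> osum l = e + a}"

definition msets_size_sum :: "nat \<Rightarrow> nat \<Rightarrow> nat multiset set" where
  "msets_size_sum e a = {M. size M = a \<and> sum_mset M = e}"

fun inc_first :: "nat list \<Rightarrow> nat list" where
  "inc_first [] = [1]"
| "inc_first (x # l) = Suc x # l"

text \<open>After prepending, the old odd-indexed parts become the even-indexed ones. In terms of the successive
differences \<open>m\<^sub>1, m\<^sub>2, \<dots>, m\<^sub>2\<^sub>t\<close> of a strict partition (padded with a zero if its length is odd), the result
has differences \<open>1, m\<^sub>2, m\<^sub>1, m\<^sub>4, m\<^sub>3, \<dots>, m\<^sub>2\<^sub>t + 1, m\<^sub>2\<^sub>t\<^sub>-\<^sub>1 - 1\<close>, so the alternating sum is unchanged;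
the last of these differences may be \<open>0\<close>.\<close>

definition prepend_reflect :: "nat list \<Rightarrow> nat list" where
  "prepend_reflect l = Suc (hd l) # reflect l"

lemma inc_first_eqpoll:
  "inc_first ` strict_parts e a \<approx> strict_parts e a"
proof (rule inj_on_image_eqpoll_self)
  have "inc_first l = inc_first l' \<Longrightarrow> strict_partition l \<Longrightarrow> strict_partition l' \<Longrightarrow> l = l'" for l l'
    by (cases l rule: inc_first.cases; cases l' rule: inc_first.cases) auto
  then show "inj_on inc_first (strict_parts e a)"
    by (auto simp: inj_on_def strict_parts_def)
qed

lemma prepend_reflect_eqpoll:
  "prepend_reflect ` strict_parts e a \<approx> strict_parts e a"
proof (rule inj_on_image_eqpoll_self)
  show "inj_on prepend_reflect (strict_parts e a)"
    by (rule inj_onI) (metis (mono_tags, lifting) strict_parts_def mem_Collect_eq prepend_reflect_def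
        list.inject reflect_reflect)
qed

lemma inc_first_in:
  "l \<in> strict_parts e a \<Longrightarrow> inc_first l \<in> strict_parts e (Suc a)"
  by (cases l rule: strict_partition.cases) (auto simp: strict_parts_def)

lemma prepend_reflect_in:
  assumes "l \<in> strict_parts e a" "a > 0"
  shows "prepend_reflect l \<in> strict_parts (e + a) a"
proof -
  obtain x r where l: "l = x # r"
    using assms by (cases l) (auto simp: strict_parts_def)
  then obtain t where t: "reflect l = x # t" using reflect_Cons by blast
  have "strict_partition l" using assms by (simp add: strict_parts_def)
  from strict_reflect[OF this] osum_reflect[OF this] esum_reflect[of x r] assms this l t
  show ?thesis by (auto simp: strict_parts_def prepend_reflect_def)
qed

text \<open>A strict partition with positive alternating sum arises by \<open>inc_first\<close> unless its first two parts
differ by exactly \<open>1\<close>. In that case, removing the first part and reflecting the rest undoes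
\<open>prepend_reflect\<close>, because \<open>reflect\<close> is an involution.\<close>

lemma strict_parts_rec:
  "strict_parts e (Suc a) = inc_first ` strict_parts e a \<union>
     (if e \<ge> Suc a then prepend_reflect ` strict_parts (e - Suc a) (Suc a) else {})" (is "?L = ?A \<union> ?B")
proof (intro equalityI subsetI)
  fix l assume "l \<in> ?A \<union> ?B"
  then show "l \<in> ?L"
    using prepend_reflect_in[of _ "e - Suc a" "Suc a"] inc_first_in by (auto split: if_splits)
next
  fix l assume l: "l \<in> ?L"
  consider (nil) "l = []" | (one) "l = [1]" | (big) x where "l = [Suc x]" "x > 0"
    | (gap) x y r where "l = Suc x # y # r" "x > y" | (succ) y r where "l = Suc y # y # r"
  proof (cases l rule: strict_partition.cases)
    case (2 z)
    with l obtain x where "z = Suc x" by (cases z) (auto simp: strict_parts_def)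
    then show ?thesis using 2 one big by (cases x) auto
  next
    case (3 z y r)
    with l obtain x where "z = Suc x" "x \<ge> y" by (cases z) (auto simp: strict_parts_def)
    then show ?thesis using 3 gap succ by (cases "x = y") auto
  qed (rule nil)
  then show "l \<in> ?A \<union> ?B"
  proof cases
    case nil then show ?thesis using l by (simp add: strict_parts_def)
  next
    case one
    then have "l = inc_first []" "[] \<in> strict_parts e a" using l by (auto simp: strict_parts_def)
    then show ?thesis by blast
  next
    case (big x)
    then have "l = inc_first [x]" "[x] \<in> strict_parts e a" using l by (auto simp: strict_parts_def)
    then show ?thesis by blast
  next
    case (gap x y r)
    then have "l = inc_first (x # y # r)" "x # y # r \<in> strict_parts e a"
      using l by (auto simp: strict_parts_def)
    then show ?thesis by blast
  next
    case (succ y r)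
    define l' where "l' = reflect (y # r)"
    have st: "strict_partition (y # r)" using l succ by (auto simp: strict_parts_def)
    obtain t where t: "l' = y # t" using reflect_Cons l'_def by blast
    have "l = prepend_reflect l'"
      using t reflect_reflect[OF st] succ by (simp add: prepend_reflect_def l'_def)
    moreover have "l' \<in> strict_parts (e - Suc a) (Suc a)" "Suc a \<le> e"
      using l succ strict_reflect[OF st] osum_reflect[OF st] esum_reflect[OF st]
        esum_le_osum(1)[OF st]  esum_le_osum(1)[OF strict_reflect[OF st]]
      by (auto simp: strict_parts_def l'_def)
    ultimately show ?thesis by auto
  qed
qed

lemma inc_first_prepend_disjnt:
  "disjnt (inc_first ` strict_parts e a) (prepend_reflect ` strict_parts e' (Suc a'))"
proof -
  have "inc_first l \<noteq> prepend_reflect l'" if mem: "l \<in> strict_parts e a" "l' \<in> strict_parts e' (Suc a')" for l l'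
  proof -
    obtain x r where l': "l' = x # r" using mem by (cases l') (auto simp: strict_parts_def)
    obtain t where "reflect l' = x # t" using reflect_Cons l' by blast
    then show ?thesis using mem l'
      by (cases l rule: strict_partition.cases) (auto simp: prepend_reflect_def strict_parts_def)
  qed
  then show ?thesis by (auto simp: disjnt_def)
qed

text \<open>Split according to whether \<open>0\<close> is an element; otherwise every element is a successor.\<close>

lemma msets_size_sum_rec:
  "msets_size_sum e (Suc a) = add_mset 0 ` msets_size_sum e a \<union>
     (if e \<ge> Suc a then image_mset Suc ` msets_size_sum (e - Suc a) (Suc a) else {})" (is "?L = ?A \<union> ?B")
proof (intro equalityI subsetI)
  have sum_Suc: "sum_mset (image_mset Suc M) = sum_mset M + size M" for M
    by (induction M) auto
  fix M
  {
    assume "M \<in> ?A \<union> ?B"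
    then show "M \<in> ?L" by (auto simp: msets_size_sum_def sum_Suc split: if_splits)
  next
    assume M: "M \<in> ?L"
    show "M \<in> ?A \<union> ?B"
    proof (cases "0 \<in># M")
      case True
      then obtain M' where "M = add_mset 0 M'" by (meson multi_member_split)
      with M show ?thesis by (auto simp: msets_size_sum_def)
    next
      case False
      define M' where "M' = image_mset (\<lambda>x. x - 1) M"
      have eq: "M = image_mset Suc M'"
        unfolding M'_def image_mset.compositionality
        by (rule sym, rule multiset.map_ident_strong) (use False in \<open>auto intro: Suc_pred gr0I\<close>)
      moreover have "M' \<in> msets_size_sum (e - Suc a) (Suc a)" "Suc a \<le> e"
        using M unfolding eq msets_size_sum_def by (auto simp: sum_Suc)
      ultimately show ?thesis by auto
    qed
  }
qed

lemma strict_parts_eqpoll: "strict_parts e a \<approx> msets_size_sum e a"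
proof (induction "e + a" arbitrary: e a rule: less_induct)
  case less
  show ?case
  proof (cases a)
    case 0
    \<comment> \<open>For alternating sum 0 only the empty partition and the empty multiset remain.\<close>
    have nil: "l = []" if "strict_partition l" "osum l = esum l" for l
      using that esum_le_osum by (cases l rule: strict_partition.cases) (fastforce dest: strict_ConsD)+
    have "l \<in> strict_parts e a \<longleftrightarrow> l = [] \<and> e = 0" for l
      using 0 nil[of l] by (auto simp: strict_parts_def)
    then have "strict_parts e a = (if e = 0 then {[]} else {})"
      by auto
    moreover have "msets_size_sum e a = (if e = 0 then {{#}} else {})"
      using 0 by (auto simp: msets_size_sum_def)
    ultimately show ?thesis by (simp add: singleton_eqpoll)
  next
    case (Suc b)
    have 1: "inc_first ` strict_parts e b \<approx> add_mset 0 ` msets_size_sum e b"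
      by (rule eqpoll_trans[OF inc_first_eqpoll], rule eqpoll_trans[OF less], use Suc in simp,
          rule eqpoll_sym, rule inj_on_image_eqpoll_self) (simp add: inj_on_def)
    have 2: "prepend_reflect ` strict_parts (e - Suc b) (Suc b)
        \<approx> image_mset Suc ` msets_size_sum (e - Suc b) (Suc b)" if "Suc b \<le> e"
      by (rule eqpoll_trans[OF prepend_reflect_eqpoll], rule eqpoll_trans[OF less],
          use Suc that in simp, rule eqpoll_sym, rule inj_on_image_eqpoll_self)
        (rule inj_on_subset[OF multiset.inj_map], simp_all)
    have disj: "disjnt (add_mset 0 ` msets_size_sum e b)
       (image_mset Suc ` msets_size_sum (e - Suc b) (Suc b))"
      by (auto simp: disjnt_def) (metis (no_types) imageE in_image_mset nat.distinct(1) union_single_eq_member)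
    show ?thesis
    proof (cases "Suc b \<le> e")
      case True
      show ?thesis
        unfolding Suc strict_parts_rec[of e b] msets_size_sum_rec[of e b] if_P[OF True]
        by (rule Un_eqpoll_cong[OF 1 2[OF True] inc_first_prepend_disjnt disj])
    next
      case False
      show ?thesis
        unfolding Suc strict_parts_rec[of e b] msets_size_sum_rec[of e b] if_not_P[OF False] Un_empty_right by (rule 1)
    qed
  qed
qed

section \<open>Partitions as multisets\<close>

definition mset_partitions :: "nat \<Rightarrow> nat multiset set" where
  "mset_partitions n = {M. 0 \<notin># M \<and> sum_mset M = n}"

lemma bij_betw_mset_partitions: "bij_betw mset (partitions_of n) (mset_partitions n)"
proof (rule bij_betwI')
  fix l l' assume *: "l \<in> partitions_of n" "l' \<in> partitions_of n"
  have sort: "sort l = rev l" if "l \<in> partitions_of n" for l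
    using that by (intro properties_for_sort) (auto simp: partitions_of_def is_partition_def sorted_wrt_rev)
  have "rev l = rev l'" if "mset l = mset l'"
    using sort[OF *(1)] sort[OF *(2)] that by (metis sorted_list_of_multiset_mset)
  then show "mset l = mset l' \<longleftrightarrow> l = l'" using rev_is_rev_conv by blast
next
  fix l assume "l \<in> partitions_of n"
  then show "mset l \<in> mset_partitions n"
    by (auto simp: partitions_of_def mset_partitions_def is_partition_def sum_mset_sum_list)
next
  fix M assume M: "M \<in> mset_partitions n"
  let ?l = "rev (sorted_list_of_multiset M)"
  have "mset ?l = M" by simp
  moreover have "sorted_wrt (\<ge>) ?l"
    by (simp add: sorted_wrt_rev)
  moreover have "\<forall>p\<in>set ?l. p > 0"
    using M by (auto simp: mset_partitions_def intro: gr0I)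
  moreover have "sum_list ?l = n"
    using M sum_mset_sum_list[of ?l] by (simp add: mset_partitions_def)
  ultimately show "\<exists>l\<in>partitions_of n. M = mset l"
    by (intro bexI[of _ ?l]) (auto simp: partitions_of_def is_partition_def)
qed

lemma card_partitions_mset:
  assumes "\<And>l. is_partition l \<Longrightarrow> Q (mset l) \<longleftrightarrow> R l"
  shows "card {l \<in> partitions_of n. R l} = card {M \<in> mset_partitions n. Q M}"
proof -
  have "mset ` {l \<in> partitions_of n. R l} = {M \<in> mset ` partitions_of n. Q M}"
    using assms by (auto simp: partitions_of_def)
  then have "bij_betw mset {l \<in> partitions_of n. R l} {M \<in> mset_partitions n. Q M}"
    using bij_betw_mset_partitions[of n] by (auto simp: bij_betw_def intro: inj_on_subset)
  then show ?thesis by (rule bij_betw_same_card)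
qed

lemma finite_mset_partitions: "finite (mset_partitions n)"
  using bij_betw_mset_partitions bij_betw_finite finite_partitions_of by blast

section \<open>The generating function of partitions with restricted parts\<close>

definition parts_gf :: "nat set \<Rightarrow> rat fps" where
  "parts_gf A = Abs_fps (\<lambda>n. of_nat (card {M \<in> mset_partitions n. set_mset M \<subseteq> A}))"

lemma parts_gf_empty: "parts_gf {} = 1"
proof -
  have "{M \<in> mset_partitions n. set_mset M \<subseteq> {}} = (if n = 0 then {{#}} else {})" for n
    by (auto simp: mset_partitions_def)
  then show ?thesis by (intro fps_ext) (simp add: parts_gf_def)
qed

text \<open>A partition with parts in \<open>insert m A\<close> either avoids \<open>m\<close> or arises from another such partition by
adding one copy of \<open>m\<close>.\<close>

lemma parts_gf_insert:
  assumes "m > 0" "m \<notin> A"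
  shows "parts_gf (insert m A) * (1 - fps_X ^ m) = parts_gf A"
proof (rule fps_ext)
  fix n
  let ?C = "\<lambda>n. {M \<in> mset_partitions n. set_mset M \<subseteq> insert m A}"
  let ?D = "{M \<in> mset_partitions n. set_mset M \<subseteq> A}"
  let ?E = "if m \<le> n then add_mset m ` ?C (n - m) else {}"
  have "?C n = ?D \<union> ?E"
  proof (intro equalityI subsetI)
    fix M assume M: "M \<in> ?C n"
    show "M \<in> ?D \<union> ?E"
    proof (cases "m \<in># M")
      case True
      then obtain M' where "M = add_mset m M'" by (meson multi_member_split)
      with M show ?thesis by (auto simp: mset_partitions_def)
    qed (use M in auto)
  qed (use assms in \<open>auto simp: mset_partitions_def split: if_splits\<close>)
  moreover have "?D \<inter> ?E = {}" using assms by auto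
  moreover have "card ?E = (if m \<le> n then card (?C (n - m)) else 0)"
    by (auto simp: card_image inj_on_def)
  ultimately have "card (?C n) = card ?D + (if m \<le> n then card (?C (n - m)) else 0)"
    by (simp add: card_Un_disjoint finite_mset_partitions)
  then show "fps_nth (parts_gf (insert m A) * (1 - fps_X ^ m)) n = fps_nth (parts_gf A) n"
    by (auto simp: parts_gf_def right_diff_distrib fps_X_power_mult_right_nth)
qed

lemma parts_gf_finite:
  assumes "finite A" "0 \<notin> A"
  shows "parts_gf A = (\<Prod>m\<in>A. inverse (1 - fps_X ^ m))"
  using assms
proof (induction A)
  case (insert m A)
  have "fps_nth (1 - fps_X ^ m :: rat fps) 0 \<noteq> 0" using insert by auto
  then have "inverse (1 - fps_X ^ m :: rat fps) * (1 - fps_X ^ m) = 1"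
    by (rule inverse_mult_eq_1)
  moreover have "parts_gf (insert m A) * (1 - fps_X ^ m) = (\<Prod>m\<in>A. inverse (1 - fps_X ^ m))"
    using insert parts_gf_insert[of m A] by auto
  ultimately have "parts_gf (insert m A) = (\<Prod>m\<in>A. inverse (1 - fps_X ^ m)) * inverse (1 - fps_X ^ m)"
    by (metis mult.commute mult.left_commute mult.right_neutral)
  then show ?case using insert by (simp add: mult.commute)
qed (simp add: parts_gf_empty)

text \<open>The partial product up to \<open>N\<close> counts the partitions with parts in \<open>A \<inter> {..N}\<close>. Its coefficient at
\<open>n\<close> is final as soon as \<open>N \<ge> n\<close>, because no part of a partition of \<open>n\<close> exceeds \<open>n\<close>.\<close>

lemma parts_gf_has_prod:
  assumes "0 \<notin> A"
  shows "(\<lambda>m. if m \<in> A then inverse (1 - fps_X ^ m) else 1) has_prod parts_gf A"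
proof -
  have part: "(\<Prod>m\<le>N. if m \<in> A then inverse (1 - fps_X ^ m) else 1) = parts_gf (A \<inter> {..N})" for N
    using assms by (subst parts_gf_finite) (auto simp: prod.If_cases Int_commute)
  have "(\<lambda>N. parts_gf (A \<inter> {..N})) \<longlonglongrightarrow> parts_gf A"
  proof (rule tendsto_fpsI)
    fix n
    have "{M \<in> mset_partitions n. set_mset M \<subseteq> A \<inter> {..N}} = {M \<in> mset_partitions n. set_mset M \<subseteq> A}"
      if "N \<ge> n" for N
    proof -
      have "x \<le> N" if "x \<in># M" "sum_mset M = n" for x M
        using that \<open>N \<ge> n\<close> by (auto dest!: multi_member_split)
      then show ?thesis by (auto simp: mset_partitions_def)
    qed
    then show "\<forall>\<^sub>F N in sequentially. fps_nth (parts_gf (A \<inter> {..N})) n = fps_nth (parts_gf A) n"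
      unfolding parts_gf_def fps_nth_Abs_fps eventually_at_top_linorder by (intro exI[of _ n]) simp
  qed
  moreover have "parts_gf A \<noteq> 0"
  proof -
    have "{M \<in> mset_partitions 0. set_mset M \<subseteq> A} = {{#}}"
      by (auto simp: mset_partitions_def) (metis multiset_nonemptyE)+
    then have "fps_nth (parts_gf A) 0 = 1" by (simp add: parts_gf_def)
    then show ?thesis by auto
  qed
  ultimately show ?thesis
    unfolding has_prod_def raw_has_prod_def add_0_right part by simp
qed

section \<open>Conjugate partitions\<close>

text \<open>Extending a partition by zeros makes the fictitious zero available as a neighbour of the last part.\<close>

definition part :: "nat list \<Rightarrow> nat \<Rightarrow> nat" where
  "part l i = (if i < length l then l ! i else 0)"

lemma mem_ferrers: "(i, j) \<in> ferrers l \<longleftrightarrow> j < part l i"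
  by (auto simp: ferrers_def part_def)

lemma ferrers_inject:
  assumes "is_partition l" "is_partition l'" "ferrers l = ferrers l'"
  shows "l = l'"
proof -
  have eq: "part l i = part l' i" for i
    using assms(3) mem_ferrers[of i _ l] mem_ferrers[of i _ l'] by (metis nat_neq_iff)
  have pos: "i < length m \<longleftrightarrow> part m i > 0" if "is_partition m" for i m
    using that by (auto simp: part_def is_partition_def)
  have "length l = length l'"
    using pos[OF assms(1)] pos[OF assms(2)] eq by (metis nat_neq_iff)
  then show ?thesis
    using eq unfolding part_def by (intro nth_equalityI) (auto, metis)
qed

lemma conjugate_conjugate: "is_partition l \<Longrightarrow> conjugate (conjugate l) = l"
  by (rule ferrers_inject) (simp_all add: ferrers_conjugate is_partition_conjugate)

lemma card_ferrers: "card (ferrers l) = sum_list l"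
proof -
  have "ferrers l = (SIGMA i:{..<length l}. {..<l ! i})"
    by (auto simp: ferrers_def)
  then show ?thesis by (simp add: sum_list_sum_nth lessThan_atLeast0)
qed

lemma sum_list_conjugate: "is_partition l \<Longrightarrow> sum_list (conjugate l) = sum_list l"
  by (metis card_ferrers card_inverse ferrers_conjugate)

text \<open>The \<open>j\<close>-th column is longer than \<open>p\<close> iff the cell \<open>(p, j)\<close> belongs to the diagram, so row
\<open>p\<close> (counted from 0) counts the columns longer than \<open>p\<close>.\<close>

lemma length_filter_conjugate:
  assumes "is_partition l"
  shows "length (filter (\<lambda>x. x > p) (conjugate l)) = part l p"
proof -
  have "j < length (conjugate l) \<and> conjugate l ! j > p \<longleftrightarrow> j < part l p" for j
    using ferrers_conjugate[OF assms] mem_ferrers[of p j l] by (auto simp: ferrers_def)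
  then have "{j. j < length (conjugate l) \<and> conjugate l ! j > p} = {..<part l p}"
    by auto
  then show ?thesis by (simp add: length_filter_conv_card)
qed

lemma count_list_eq_filter: "count_list l (Suc p) = length (filter (\<lambda>x. x > p) l) - length (filter (\<lambda>x. x > Suc p) l)"
proof -
  have "length (filter (\<lambda>x. x > p) l) = count_list l (Suc p) + length (filter (\<lambda>x. x > Suc p) l)"
    by (induction l) auto
  then show ?thesis by simp
qed

lemma Min_partition:
  assumes "is_partition l" "l \<noteq> []"
  shows "Min (set l) = l ! (length l - 1)"
proof (rule Min_eqI)
  fix y assume "y \<in> set l"
  then show "l ! (length l - 1) \<le> y"
    using partition_nth_mono[OF assms(1), of _ "length l - 1"] by (auto simp: in_set_conv_nth)
qed (use assms in auto)

text \<open>In the conjugate, \<open>Suc i\<close> has multiplicity \<open>part l i - part l (Suc i)\<close>, and \<open>part l (Suc i)\<close> parts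
are larger. The differences in the right-hand side therefore are multiplicities.\<close>

lemma cond_C_conjugate_iff:
  assumes "is_partition l"
  shows "cond_C k (conjugate l) \<longleftrightarrow>
    (\<forall>i. part l i - part l (Suc i) \<notin> small_odds k \<and>
         (part l i - part l (Suc i) = 2 * k + 3 \<longrightarrow> even (part l (Suc i))))"
proof -
  let ?c = "conjugate l"
  have cnt: "count_list ?c (Suc i) = part l i - part l (Suc i)" for i
    by (simp add: count_list_eq_filter length_filter_conjugate assms)
  have pos: "p \<noteq> 0" if "p \<in> set ?c" for p
    using is_partition_conjugate[OF assms] that by (auto simp: is_partition_def)
  have "cond_C k ?c \<longleftrightarrow> (\<forall>p. p \<noteq> 0 \<longrightarrow> count_list ?c p \<notin> small_odds k \<and>
      (count_list ?c p = 2 * k + 3 \<longrightarrow> even (part l p)))"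
    \<comment> \<open>A number that is not a part has multiplicity 0, which is neither odd nor \<open>2k+3\<close>.\<close>
    unfolding cond_C_def length_filter_conjugate[OF assms]
    using pos by (auto simp: small_odds_def)
  also have "\<dots> \<longleftrightarrow> (\<forall>i. count_list ?c (Suc i) \<notin> small_odds k \<and>
      (count_list ?c (Suc i) = 2 * k + 3 \<longrightarrow> even (part l (Suc i))))"
    by (metis nat.distinct(1) not0_implies_Suc)
  finally show ?thesis by (simp only: cnt)
qed

text \<open>If \<open>a = b + (2k+3)\<close> then exactly one of \<open>a\<close> and \<open>b\<close> is even, so forbidding an even \<open>a\<close> amounts to
requiring an even \<open>b\<close>. At the fictitious zero \<open>b = 0\<close> is even, hence only the condition on the
difference says anything there, and this is the initial condition.\<close>

lemma cond_S_iff: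
  assumes "is_partition l"
  shows "cond_S k l \<longleftrightarrow>
    (\<forall>i. part l i - part l (Suc i) \<notin> small_odds k \<and>
         (part l i - part l (Suc i) = 2 * k + 3 \<longrightarrow> even (part l (Suc i))))"
proof -
  have diff: "part l i - part l (Suc i) \<notin> small_odds k" if "i \<ge> length l" for i
    using that by (simp add: part_def small_odds_def)
  have 1: "(\<forall>a b. adjacent l a b \<longrightarrow> a - b \<notin> small_odds k) \<longleftrightarrow>
      (\<forall>i. Suc i < length l \<longrightarrow> part l i - part l (Suc i) \<notin> small_odds k)"
    by (auto simp: adjacent_def part_def)
  have 2: "(\<forall>j b. adjacent l (2 * j) b \<longrightarrow> int b \<noteq> 2 * int j - 2 * int k - 3) \<longleftrightarrow>
      (\<forall>i. part l i - part l (Suc i) = 2 * k + 3 \<longrightarrow> even (part l (Suc i)))" (is "?L \<longleftrightarrow> ?R")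
  proof
    assume L: ?L
    show ?R
    proof (intro allI impI)
      fix i assume d: "part l i - part l (Suc i) = 2 * k + 3"
      show "even (part l (Suc i))"
      proof (rule ccontr)
        assume odd: "odd (part l (Suc i))"
        then have len: "Suc i < length l" by (auto simp: part_def split: if_splits)
        have sum: "part l i = part l (Suc i) + (2 * k + 3)" using d by simp
        with odd have "even (part l i)" by simp
        then obtain j where j: "part l i = 2 * j" by blast
        with len have "adjacent l (2 * j) (part l (Suc i))" by (auto simp: adjacent_def part_def)
        with L have "int (part l (Suc i)) \<noteq> 2 * int j - 2 * int k - 3" by blast
        then show False using sum j by presburger
      qed
    qed
  next
    assume R: ?R
    show ?L
    proof (intro allI impI notI)
      fix j b assume "adjacent l (2 * j) b" and b: "int b = 2 * int j - 2 * int k - 3"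
      then obtain i where "Suc i < length l" "l ! i = 2 * j" "l ! Suc i = b"
        by (auto simp: adjacent_def)
      then have i: "part l i = 2 * j" "part l (Suc i) = b" by (auto simp: part_def)
      have e: "2 * j = b + (2 * k + 3)" using b by linarith
      then have "even b" using R i by auto
      then show False using e by presburger
    qed
  qed
  have 3: "(l \<noteq> [] \<longrightarrow> Min (set l) \<notin> small_odds k) \<longleftrightarrow>
      (\<forall>i. Suc i = length l \<longrightarrow> part l i - part l (Suc i) \<notin> small_odds k)"
    using Min_partition[OF assms] by (cases l rule: rev_cases) (auto simp: part_def)
  show ?thesis
    unfolding cond_S_def 1 2 3 using diff by (metis Suc_lessI not_less)
qed

corollary cond_S_iff_cond_C_conjugate:
  "is_partition l \<Longrightarrow> cond_S k l \<longleftrightarrow> cond_C k (conjugate l)"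
  by (simp only: cond_S_iff cond_C_conjugate_iff)

lemma card_cond_S_eq_cond_C:
  "card {l \<in> partitions_of n. cond_S k l} = card {l \<in> partitions_of n. cond_C k l}"
proof -
  have "bij_betw conjugate {l \<in> partitions_of n. cond_S k l} {l \<in> partitions_of n. cond_C k l}"
    by (rule bij_betw_byWitness[of _ conjugate])
      (auto simp: partitions_of_def conjugate_conjugate is_partition_conjugate sum_list_conjugate
        cond_S_iff_cond_C_conjugate)
  then show ?thesis by (rule bij_betw_same_card)
qed

section \<open>Partitions with restricted multiplicities\<close>

definition mset_cond_C :: "nat \<Rightarrow> nat multiset \<Rightarrow> bool" where
  "mset_cond_C k M \<longleftrightarrow>
     (\<forall>p\<in>#M. count M p \<notin> small_odds k \<and>
       (count M p = 2 * k + 3 \<longrightarrow> even (size (filter_mset (\<lambda>x. x > p) M))))"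

lemma mset_cond_C_mset: "mset_cond_C k (mset l) \<longleftrightarrow> cond_C k l"
  by (auto simp: mset_cond_C_def cond_C_def count_mset mset_filter[symmetric] simp del: mset_filter)

lemma odd_count_mem: "odd (count M p) \<Longrightarrow> p \<in># M"
  by (metis even_zero not_in_iff)

lemma finite_odd_count: "finite {p. odd (count M p)}"
  by (rule finite_subset[of _ "set_mset M"]) (auto intro: odd_count_mem)

lemma strict_imp_distinct: "strict_partition l \<Longrightarrow> distinct l"
  by (induction l) (auto simp: strict_iff)

lemma strict_set_inject:
  assumes "strict_partition l" "strict_partition l'" "set l = set l'"
  shows "l = l'"
proof -
  have "sorted (rev l)" if "strict_partition l" for l
    using that by (auto simp: strict_iff sorted_wrt_rev intro: sorted_wrt_mono_rel[of l "(>)"])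
  then have "rev l = rev l'"
    using assms by (intro sorted_distinct_set_unique) (auto intro: strict_imp_distinct)
  then show ?thesis by simp
qed

lemma ex_strict_set:
  assumes "finite A" "0 \<notin> A"
  obtains l where "strict_partition l" "set l = A"
proof
  show "set (rev (sorted_list_of_set A)) = A" using assms by simp
  then show "strict_partition (rev (sorted_list_of_set A))"
    using assms by (auto simp: strict_iff sorted_wrt_rev intro: gr0I)
qed

text \<open>The minimal multiplicities for the parts with odd multiplicity, listed from the largest part on.\<close>

fun alternate :: "nat \<Rightarrow> nat \<Rightarrow> nat list \<Rightarrow> nat multiset" where
  "alternate a b [] = {#}"
| "alternate a b (x # l) = replicate_mset a x + alternate b a l"

lemma count_alternate:
  assumes "strict_partition l"
  shows "count (alternate a b l) p =
    (if p \<in> set l then if even (length (filter (\<lambda>x. x > p) l)) then a else b else 0)"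
  using assms
proof (induction l arbitrary: a b)
  case (Cons x l)
  have "strict_partition l" using Cons.prems strict_ConsD by blast
  moreover have "\<forall>y\<in>set l. y < x" using Cons.prems by (simp add: strict_iff)
  moreover from this have "filter (\<lambda>y. y > x) l = []" by (auto simp: filter_empty_conv)
  ultimately show ?case using Cons.IH[of b a] by auto
qed simp

lemma sum_mset_alternate: "sum_mset (alternate a b l) = a * osum l + b * esum l"
  by (induction l arbitrary: a b) (auto simp: algebra_simps)

text \<open>Parts with even multiplicity do not influence the parity of a number of parts.\<close>

lemma even_size_filter_iff:
  assumes "strict_partition l" "set l = {p. odd (count M p)}"
  shows "even (size (filter_mset Q M)) \<longleftrightarrow> even (length (filter Q l))"
proof -
  have "{p. p \<in># M \<and> Q p \<and> odd (count M p)} = {p. Q p} \<inter> set l"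
    unfolding assms(2) by (auto intro: odd_count_mem)
  then show ?thesis
    using strict_imp_distinct[OF assms(1)]
    by (simp add: size_multiset_overloaded_eq even_sum_iff distinct_length_filter)
qed

lemma ex_half_mset:
  assumes "\<And>p. count W p \<le> count M p" "\<And>p. even (count M p - count W p)"
  obtains H where "M = H + H + W"
proof -
  have fin: "finite {p. (count M p - count W p) div 2 > 0}"
    by (rule finite_subset[of _ "set_mset M"])
      (auto simp: count_greater_zero_iff[symmetric] simp del: count_greater_zero_iff)
  define H where "H = Abs_multiset (\<lambda>p. (count M p - count W p) div 2)"
  have "M = H + H + W"
  proof (rule multiset_eqI)
    fix p
    have "2 * count H p = count M p - count W p"
      using assms(2) by (simp add: H_def count_Abs_multiset[OF fin])
    then show "count M p = count (H + H + W) p" using assms(1)[of p] by simp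
  qed
  then show ?thesis by (rule that)
qed

definition C_data :: "nat \<Rightarrow> nat \<Rightarrow> (nat multiset \<times> nat list) set" where
  "C_data k n = {(H, l). 0 \<notin># H \<and> strict_partition l \<and>
     2 * sum_mset H + (2 * k + 3) * osum l + (2 * k + 5) * esum l = n}"

lemma odd_count_assembled:
  assumes "strict_partition l" "odd a" "odd b"
  shows "{p. odd (count (H + H + alternate a b l) p)} = set l"
  using assms by (auto simp: count_alternate)

text \<open>The list \<open>l\<close> consists of the parts with odd multiplicity. By \<open>even_size_filter_iff\<close>, the number of
parts above an entry of \<open>l\<close> has the parity of the index of that entry, counted from 0. So the forbidden
multiplicity \<open>2k+3\<close> concerns precisely the entries to which \<open>alternate\<close> gives \<open>2k+5\<close> copies.\<close>

lemma bij_betw_C_data: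
  "bij_betw (\<lambda>(H, l). H + H + alternate (2 * k + 3) (2 * k + 5) l) (C_data k n)
     {M \<in> mset_partitions n. mset_cond_C k M}"
proof (rule bij_betwI')
  let ?W = "alternate (2 * k + 3) (2 * k + 5)"
  fix x y assume *: "x \<in> C_data k n" "y \<in> C_data k n"
  obtain H l H' l' where xy: "x = (H, l)" "y = (H', l')" by fastforce
  have st: "strict_partition l" "strict_partition l'" using * xy by (auto simp: C_data_def)
  have "x = y" if eq: "H + H + ?W l = H' + H' + ?W l'"
  proof -
    have "set l = set l'"
      using odd_count_assembled[OF st(1), of "2 * k + 3" "2 * k + 5" H]
        odd_count_assembled[OF st(2), of "2 * k + 3" "2 * k + 5" H'] unfolding eq by simp
    then have l: "l = l'" using strict_set_inject st by blast
    have "count H p = count H' p" for p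
      using arg_cong[OF eq, of "\<lambda>M. count M p"] l by simp
    then show ?thesis using l xy by (auto intro: multiset_eqI)
  qed
  then show "((\<lambda>(H, l). H + H + ?W l) x = (\<lambda>(H, l). H + H + ?W l) y) \<longleftrightarrow> x = y"
    by (auto simp: xy)
next
  let ?W = "alternate (2 * k + 3) (2 * k + 5)"
  fix x assume *: "x \<in> C_data k n"
  obtain H l where x: "x = (H, l)" by fastforce
  have st: "strict_partition l" using * x by (auto simp: C_data_def)
  let ?M = "H + H + ?W l"
  have cnt: "count ?M p = 2 * count H p +
      (if p \<in> set l then if even (length (filter (\<lambda>x. x > p) l)) then 2 * k + 3 else 2 * k + 5 else 0)" for p
    by (simp add: count_alternate[OF st])
  have par: "even (size (filter_mset Q ?M)) \<longleftrightarrow> even (length (filter Q l))" for Q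
    by (rule even_size_filter_iff[OF st], rule odd_count_assembled[symmetric]) (use st in auto)
  have "0 \<notin> set l" using st by (auto simp: strict_iff)
  then have "0 \<notin># ?M" using * x cnt[of 0] by (auto simp: C_data_def count_eq_zero_iff[symmetric])
  moreover have "sum_mset ?M = n" using * x by (simp add: C_data_def sum_mset_alternate)
  moreover have "2 * m \<noteq> 2 * k + 3" for m by presburger
  then have "mset_cond_C k ?M"
    unfolding mset_cond_C_def par cnt small_odds_def by auto
  ultimately show "(\<lambda>(H, l). H + H + ?W l) x \<in> {M \<in> mset_partitions n. mset_cond_C k M}"
    by (simp add: x mset_partitions_def)
next
  let ?W = "alternate (2 * k + 3) (2 * k + 5)"
  fix M assume M: "M \<in> {M \<in> mset_partitions n. mset_cond_C k M}"
  have "0 \<notin> {p. odd (count M p)}" using M odd_count_mem[of M 0] by (auto simp: mset_partitions_def)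
  then obtain l where l: "strict_partition l" "set l = {p. odd (count M p)}"
    using ex_strict_set[OF finite_odd_count] by metis
  have cnt: "count (?W l) p \<le> count M p \<and> even (count M p - count (?W l) p)" for p
  proof (cases "p \<in> set l")
    case True
    then have odd: "odd (count M p)" using l by simp
    then have "p \<in># M" by (rule odd_count_mem)
    then have "count M p \<notin> small_odds k"
      "count M p = 2 * k + 3 \<Longrightarrow> even (length (filter (\<lambda>x. x > p) l))"
      using M even_size_filter_iff[OF l] by (auto simp: mset_cond_C_def)
    with odd have "count M p \<ge> 2 * k + 3"
      "odd (length (filter (\<lambda>x. x > p) l)) \<Longrightarrow> count M p \<ge> 2 * k + 5"
      unfolding small_odds_def mem_Collect_eq by presburger+
    then show ?thesis using True odd by (simp add: count_alternate[OF l(1)])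
  qed (use l in \<open>auto simp: count_alternate[OF l(1)]\<close>)
  then obtain H where H: "M = H + H + ?W l" using ex_half_mset[of "?W l" M] by blast
  have "(H, l) \<in> C_data k n"
    using M l H by (auto simp: C_data_def mset_partitions_def sum_mset_alternate)
  then show "\<exists>x\<in>C_data k n. M = (\<lambda>(H, l). H + H + ?W l) x"
    using H by (intro bexI[of _ "(H, l)"]) auto
qed

section \<open>Partitions with restricted odd parts\<close>

definition P_data :: "nat \<Rightarrow> nat \<Rightarrow> (nat multiset \<times> nat multiset) set" where
  "P_data k n = {(H, T). 0 \<notin># H \<and>
     2 * sum_mset H + (2 * k + 3) * size T + (4 * k + 8) * sum_mset T = n}"

definition mset_cond_P :: "nat \<Rightarrow> nat multiset \<Rightarrow> bool" where
  "mset_cond_P k M \<longleftrightarrow> (\<forall>p\<in>#M. even p \<or> [p = 2 * k + 3] (mod (4 * k + 8)))"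

text \<open>The two kinds of parts are told apart by their parity, since \<open>2k+3\<close> is odd and \<open>4k+8\<close> is even.\<close>

lemma bij_betw_P_data:
  "bij_betw (\<lambda>(H, T). image_mset (\<lambda>p. 2 * p) H + image_mset (\<lambda>c. (4 * k + 8) * c + (2 * k + 3)) T)
     (P_data k n) {M \<in> mset_partitions n. mset_cond_P k M}"
    (is "bij_betw ?f _ ?B")
proof (rule bij_betw_byWitness)
  let ?h = "\<lambda>c. (4 * k + 8) * c + (2 * k + 3)"
  let ?g = "\<lambda>M. (image_mset (\<lambda>p. p div 2) (filter_mset even M),
                  image_mset (\<lambda>p. p div (4 * k + 8)) (filter_mset odd M))"
  have div: "?h c div (4 * k + 8) = c" for c
    by (simp add: div_mult_self1[of "4 * k + 8"])
  have sum: "sum_mset (image_mset (\<lambda>p. 2 * p) H) = 2 * sum_mset H"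
    "sum_mset (image_mset ?h T) = (2 * k + 3) * size T + (4 * k + 8) * sum_mset T" for H T :: "nat multiset"
    by (induction H, auto, induction T) (auto simp: algebra_simps)
  show "\<forall>x\<in>P_data k n. ?g (?f x) = x"
    by (auto simp: filter_mset_image_mset multiset.map_comp o_def div simp del: mult_Suc_right)
  have inv: "?f (?g M) = M" if "M \<in> ?B" for M
  proof -
    have "image_mset (\<lambda>p. 2 * (p div 2)) (filter_mset even M) = filter_mset even M"
      by (rule multiset.map_ident_strong) auto
    moreover have "image_mset (\<lambda>p. ?h (p div (4 * k + 8))) (filter_mset odd M) = filter_mset odd M"
    proof (rule multiset.map_ident_strong)
      fix p assume "p \<in># filter_mset odd M"
      then have "[p = 2 * k + 3] (mod (4 * k + 8))" using that by (auto simp: mset_cond_P_def)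
      then have "p mod (4 * k + 8) = 2 * k + 3" by (simp add: cong_def)
      then show "?h (p div (4 * k + 8)) = p"
        using mult_div_mod_eq[of "4 * k + 8" p] by metis
    qed
    ultimately show ?thesis by (simp add: multiset.map_comp o_def)
  qed
  then show "\<forall>M\<in>?B. ?f (?g M) = M" by blast
  show "?f ` P_data k n \<subseteq> ?B"
    by (auto simp: P_data_def mset_partitions_def sum mset_cond_P_def cong_def)
  show "?g ` ?B \<subseteq> P_data k n"
  proof (intro subsetI, elim imageE)
    fix x M assume x: "x = ?g M" and M: "M \<in> ?B"
    obtain H T where HT: "x = (H, T)" by fastforce
    have "?f x = M" using inv[OF M] x by simp
    then have "M = image_mset (\<lambda>p. 2 * p) H + image_mset ?h T" by (simp add: HT)
    then show "x \<in> P_data k n"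
      using M by (auto simp: P_data_def mset_partitions_def sum HT)
  qed
qed

section \<open>The partition identity\<close>

text \<open>If \<open>e\<close> and \<open>a\<close> are the even-indexed and the alternating sum of \<open>l\<close>, the two weights agree because
\<open>(2k+3)(e + a) + (2k+5)e = (2k+3)a + (4k+8)e\<close>. So \<open>H\<close> can be kept, and \<open>l\<close> is mapped by the
bijections of \<open>strict_parts_eqpoll\<close>, one for each pair \<open>(e, a)\<close>.\<close>

lemma card_C_data_eq_P_data: "card (C_data k n) = card (P_data k n)"
proof -
  obtain g where g: "bij_betw (g e a) (strict_parts e a) (msets_size_sum e a)" for e a
    using strict_parts_eqpoll unfolding eqpoll_def by metis
  define G where "G l = g (esum l) (osum l - esum l) l" for l
  have in_parts: "l \<in> strict_parts (esum l) (osum l - esum l)" if "strict_partition l" for l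
    using esum_le_osum(1)[OF that] that by (simp add: strict_parts_def)
  have G: "sum_mset (G l) = esum l" "size (G l) + esum l = osum l" if "strict_partition l" for l
    using bij_betwE[OF g] in_parts[OF that] esum_le_osum(1)[OF that]
    by (auto simp: G_def msets_size_sum_def)
  have "bij_betw (\<lambda>(H, l). (H, G l)) (C_data k n) (P_data k n)"
  proof (rule bij_betwI')
    fix x y assume "x \<in> C_data k n" "y \<in> C_data k n"
    moreover have "l = l'" if "strict_partition l" "strict_partition l'" "G l = G l'" for l l'
    proof -
      have "esum l = esum l'" "osum l = osum l'" using G that by metis+
      then show ?thesis
        using that in_parts[of l] in_parts[of l'] bij_betw_imp_inj_on[OF g]
        by (auto simp: G_def dest: inj_onD)
    qed
    ultimately show "((\<lambda>(H, l). (H, G l)) x = (\<lambda>(H, l). (H, G l)) y) \<longleftrightarrow> x = y"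
      by (auto simp: C_data_def)
  next
    fix x assume "x \<in> C_data k n"
    then obtain H l where x: "x = (H, l)" "0 \<notin># H" and l: "strict_partition l"
      and n: "2 * sum_mset H + (2 * k + 3) * osum l + (2 * k + 5) * esum l = n"
      by (auto simp: C_data_def)
    have "2 * sum_mset H + (2 * k + 3) * size (G l) + (4 * k + 8) * sum_mset (G l) = n"
      using n unfolding G(1)[OF l] G(2)[OF l, symmetric] by (simp add: algebra_simps)
    then show "(\<lambda>(H, l). (H, G l)) x \<in> P_data k n"
      using x by (simp add: P_data_def)
  next
    fix y assume "y \<in> P_data k n"
    then obtain H T where y: "y = (H, T)" "0 \<notin># H"
      and n: "2 * sum_mset H + (2 * k + 3) * size T + (4 * k + 8) * sum_mset T = n"
      by (auto simp: P_data_def)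
    have "T \<in> msets_size_sum (sum_mset T) (size T)" by (simp add: msets_size_sum_def)
    then obtain l where l: "l \<in> strict_parts (sum_mset T) (size T)" "g (sum_mset T) (size T) l = T"
      using g by (metis bij_betw_imp_surj_on imageE)
    then have l': "strict_partition l" "esum l = sum_mset T" "osum l = sum_mset T + size T" "G l = T"
      by (auto simp: strict_parts_def G_def)
    have "2 * sum_mset H + (2 * k + 3) * osum l + (2 * k + 5) * esum l = n"
      using n unfolding l' by (simp add: algebra_simps)
    then show "\<exists>x\<in>C_data k n. y = (\<lambda>(H, l). (H, G l)) x"
      using y l' by (intro bexI[of _ "(H, l)"]) (auto simp: C_data_def)
  qed
  then show ?thesis by (rule bij_betw_same_card)
qed

theorem mainTheorem9:
  fixes k :: nat
  assumes "k \<ge> 1"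
  shows "(\<forall>n. card {l \<in> partitions_of n. cond_P k l} = card {l \<in> partitions_of n. cond_S k l}) \<and>
    (\<lambda>m. if m \<ge> 1 \<and> (even m \<or> [m = 2 * k + 3] (mod (4 * k + 8)))
         then inverse (1 - fps_X ^ m) else 1) has_prod P_gf k \<and>
    (\<forall>l. is_partition l \<longrightarrow> (cond_S k l \<longleftrightarrow> cond_C k (conjugate l)))"
proof (intro conjI allI impI)
  have card_P: "card {l \<in> partitions_of n. cond_P k l} = card {M \<in> mset_partitions n. mset_cond_P k M}" for n
    by (rule card_partitions_mset) (simp add: cond_P_def mset_cond_P_def)
  fix n
  have "card {l \<in> partitions_of n. cond_P k l} = card (P_data k n)"
    using card_P bij_betw_same_card[OF bij_betw_P_data] by simp
  also have "\<dots> = card (C_data k n)" by (rule card_C_data_eq_P_data[symmetric])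
  also have "\<dots> = card {M \<in> mset_partitions n. mset_cond_C k M}"
    by (rule bij_betw_same_card[OF bij_betw_C_data])
  also have "\<dots> = card {l \<in> partitions_of n. cond_C k l}"
    by (rule card_partitions_mset[symmetric]) (rule mset_cond_C_mset)
  also have "\<dots> = card {l \<in> partitions_of n. cond_S k l}"
    by (rule card_cond_S_eq_cond_C[symmetric])
  finally show "card {l \<in> partitions_of n. cond_P k l} = card {l \<in> partitions_of n. cond_S k l}" .
next
  let ?A = "{m. m \<ge> 1 \<and> (even m \<or> [m = 2 * k + 3] (mod (4 * k + 8)))}"
  have "{M \<in> mset_partitions n. mset_cond_P k M} = {M \<in> mset_partitions n. set_mset M \<subseteq> ?A}" for n
    by (auto simp: mset_partitions_def mset_cond_P_def Suc_le_eq intro: gr0I)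
  then have "card {l \<in> partitions_of n. cond_P k l} = card {M \<in> mset_partitions n. set_mset M \<subseteq> ?A}" for n
    using card_partitions_mset[of "mset_cond_P k" "cond_P k" n]
    by (simp add: cond_P_def mset_cond_P_def)
  then have "P_gf k = parts_gf ?A"
    by (intro fps_ext) (simp add: P_gf_def parts_gf_def)
  then show "(\<lambda>m. if m \<ge> 1 \<and> (even m \<or> [m = 2 * k + 3] (mod (4 * k + 8)))
         then inverse (1 - fps_X ^ m) else 1) has_prod P_gf k"
    using parts_gf_has_prod[of ?A] by simp
next
  fix l assume "is_partition l"
  then show "cond_S k l \<longleftrightarrow> cond_C k (conjugate l)"
    by (rule cond_S_iff_cond_C_conjugate)
qed

end
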